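(* Let $\mathcal{F}$ be a financial network in which every bank uses an edge-ranking rule. A debt swap $\sigma$ in $\mathcal{F}$ is semi-positive if and only if it is Pareto-improving.
   Context: A financial network $\mathcal{F}=(G,\mathbf{l},\mathbf{a}^x,\mathbf{f})$ consists of a finite directed graph $G=(V,E)$ without loops or parallel edges (nodes are banks), a liability $l_e\in\mathbb{N}_{>0}$ for each edge $e=(u,w)$ (bank $u$ owes bank $w$ the amount $l_e$), external assets $a^x_v\in\mathbb{N}$ for each bank $v$, and an allocation rule $\mathbf{f}$ assigning to every outgoing edge $e\in E^+(v)$ of bank $v$ a payment function $f_e:\mathbb{R}_{\ge 0}\to[0,l_e]$ which is continuous and non-decreasing, such that $\sum_{e\in E^+(v)}f_e(b)=\min\{b,L_v\}$ for all $b\ge0$, where $L_v=\sum_{e\in E^+(v)}l_e$. $E^-(v)$ denotes the incoming edges of $v$. A vector $(b_v)_{v\in V}\ge 0$ is feasible if $b_v=a^x_v+\sum_{e=(u,v)\in E^-(v)}f_e(b_u)$ for all $v$; the feasible vectors form a complete lattice, and the clearing state consists of the pointwise maximal feasible vector $(a_v)_{v\in V}$ (the total assets) and the payments $p_e=f_e(a_u)$ for $e=(u,w)$. In an edge-ranking rule, each bank $v$ has a linear order of $E^+(v)$ and pays its available assets to these edges in this order, paying each edge fully before paying the next one, until its assets are exhausted or all edges are fully paid. A debt swap $\sigma$ of two edges $e_1=(u_1,v_1)$, $e_2=(u_2,v_2)$ with $l_{e_1}=l_{e_2}$ and $u_1,v_1,u_2,v_2$ pairwise distinct yields $\mathcal{F}^\sigma$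 by removing $e_1,e_2$ and adding $(u_1,v_2)$ and $(u_2,v_1)$, both with liability $l_{e_1}$, where $(u_1,v_2)$ takes over the payment function (ranking position) of $e_1$ and $(u_2,v_1)$ that of $e_2$; all else unchanged. $a_w,a^\sigma_w$ denote total assets in the clearing states before and after the swap. The swap is semi-positive if $a^\sigma_{v_1}\ge a_{v_1}$ and $a^\sigma_{v_2}\ge a_{v_2}$ with exactly one of the inequalities strict; it is Pareto-improving if $a^\sigma_w\ge a_w$ for all $w\in V$ with at least one inequality strict. *)

theory Defs
  imports "HOL-Analysis.Analysis" "Graph_Theory.Digraph"
begin

(* Arcs are identities of their own, with end points given by tail and head.  This matters for the
   swap below, which can put a new arc next to an existing one with the same end points. *)
record ('v, 'e) network =
  bank_graph :: "('v, 'e) pre_digraph"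
  liability :: "'e \<Rightarrow> nat"
  external_assets :: "'v \<Rightarrow> nat"
  payment :: "'e \<Rightarrow> real \<Rightarrow> real"

definition total_liability :: "('v, 'e) network \<Rightarrow> 'v \<Rightarrow> real" where
  "total_liability F v = (\<Sum>e \<in> out_arcs (bank_graph F) v. real (liability F e))"

locale financial_multinetwork =
  fin_digraph "bank_graph F" + loopfree_digraph "bank_graph F"
  for F :: "('v, 'e) network" +
  assumes liability_pos: "e \<in> arcs (bank_graph F) \<Longrightarrow> 0 < liability F e"
    and payment_range: "e \<in> arcs (bank_graph F) \<Longrightarrow> payment F e \<in> {0..} \<rightarrow> {0..real (liability F e)}"
    and payment_continuous: "e \<in> arcs (bank_graph F) \<Longrightarrow> continuous_on {0..} (payment F e)"
    and payment_mono: "e \<in> arcs (bank_graph F) \<Longrightarrow> mono_on {0..} (payment F e)"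
    and payment_sum: "v \<in> verts (bank_graph F) \<Longrightarrow> 0 \<le> b \<Longrightarrow>
      (\<Sum>e \<in> out_arcs (bank_graph F) v. payment F e b) = min b (total_liability F v)"

locale financial_network = financial_multinetwork F + nomulti_digraph "bank_graph F"
  for F :: "('v, 'e) network"

(* Being extensional makes a vector determined by its values on the banks, so that the order on
   functions restricts to the pointwise order over the banks. *)
definition feasible :: "('v, 'e) network \<Rightarrow> ('v \<Rightarrow> real) \<Rightarrow> bool" where
  "feasible F b \<longleftrightarrow> b \<in> verts (bank_graph F) \<rightarrow>\<^sub>E {0..} \<and>
    (\<forall>v \<in> verts (bank_graph F). b v = real (external_assets F v) +
      (\<Sum>e \<in> in_arcs (bank_graph F) v. payment F e (b (tail (bank_graph F) e))))"

definition total_assets :: "('v, 'e) network \<Rightarrow> 'v \<Rightarrow> real" where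
  "total_assets F = (GREATEST b. feasible F b)"

(* r ranks the arcs leaving v, highest priority first; every arc receives what is left
   after the payments to the arcs ranked strictly before it, up to its liability. *)
definition uses_edge_ranking :: "('v, 'e) network \<Rightarrow> 'v \<Rightarrow> bool" where
  "uses_edge_ranking F v \<longleftrightarrow> (\<exists>r. linear_order_on (out_arcs (bank_graph F) v) r \<and>
    (\<forall>e \<in> out_arcs (bank_graph F) v. \<forall>b \<ge> 0.
      payment F e b = min (real (liability F e)) (b - (\<Sum>e' \<in> underS r e. payment F e' b))))"

definition debt_swap :: "('v, 'e) network \<Rightarrow> 'e \<Rightarrow> 'e \<Rightarrow> bool" where
  "debt_swap F e1 e2 \<longleftrightarrow> e1 \<in> arcs (bank_graph F) \<and> e2 \<in> arcs (bank_graph F) \<and>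
    liability F e1 = liability F e2 \<and>
    distinct [tail (bank_graph F) e1, head (bank_graph F) e1,
              tail (bank_graph F) e2, head (bank_graph F) e2]"

(* With e1 = (u1, v1) and e2 = (u2, v2), the new arc (u1, v2) reuses the identity e1 and (u2, v1)
   reuses e2.  Thus each inherits liability, payment function and ranking position of the arc
   that it replaces. *)
definition swapped :: "('v, 'e) network \<Rightarrow> 'e \<Rightarrow> 'e \<Rightarrow> ('v, 'e) network" where
  "swapped F e1 e2 = F\<lparr>bank_graph := (bank_graph F)\<lparr>head :=
    (head (bank_graph F))(e1 := head (bank_graph F) e2, e2 := head (bank_graph F) e1)\<rparr>\<rparr>"

definition semi_positive :: "('v, 'e) network \<Rightarrow> 'e \<Rightarrow> 'e \<Rightarrow> bool" where
  "semi_positive F e1 e2 \<longleftrightarrow>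
    (let v1 = head (bank_graph F) e1; v2 = head (bank_graph F) e2;
         a = total_assets F; a' = total_assets (swapped F e1 e2)
     in a v1 \<le> a' v1 \<and> a v2 \<le> a' v2 \<and> (a v1 < a' v1 \<longleftrightarrow> \<not> a v2 < a' v2))"

definition pareto_improving :: "('v, 'e) network \<Rightarrow> 'e \<Rightarrow> 'e \<Rightarrow> bool" where
  "pareto_improving F e1 e2 \<longleftrightarrow>
    (let a = total_assets F; a' = total_assets (swapped F e1 e2)
     in (\<forall>w \<in> verts (bank_graph F). a w \<le> a' w) \<and> (\<exists>w \<in> verts (bank_graph F). a w < a' w))"

(* The greatest feasible vector exists, so the GREATEST in total_assets is well defined,
   both before and after a swap. *)

context financial_multinetwork
begin

lemma payment_le: "e \<in> arcs (bank_graph F) \<Longrightarrow> 0 \<le> x \<Longrightarrow> x \<le> y \<Longrightarrow> payment F e x \<le> payment F e y"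
  using payment_mono[of e] by (auto simp: mono_on_def)

lemma payment_bounds:
  "e \<in> arcs (bank_graph F) \<Longrightarrow> 0 \<le> x \<Longrightarrow> 0 \<le> payment F e x \<and> payment F e x \<le> real (liability F e)"
  using payment_range[of e] by (auto simp: Pi_iff)

lemma greatest_feasible_exists: "\<exists>a. feasible F a \<and> (\<forall>b. feasible F b \<longrightarrow> b \<le> a)"
proof -
  let ?V = "verts (bank_graph F)"
  define D :: "('v \<Rightarrow> real) set" where "D = ?V \<rightarrow>\<^sub>E {0..}"
  define S where "S b v = real (external_assets F v) +
      (\<Sum>e \<in> in_arcs (bank_graph F) v. payment F e (b (tail (bank_graph F) e)))" for b v
  define X where "X = {b \<in> D. \<forall>v \<in> ?V. b v \<le> S b v}"
  define a where "a = restrict (\<lambda>v. SUP b\<in>X. b v) ?V"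
  have feas: "feasible F b \<longleftrightarrow> b \<in> D \<and> (\<forall>v \<in> ?V. b v = S b v)" for b
    by (simp only: feasible_def D_def S_def)
  have D_pos: "0 \<le> b v" if "b \<in> D" "v \<in> ?V" for b v
    using PiE_mem[OF that[unfolded D_def]] by simp
  have S_pos: "0 \<le> S b v" if "b \<in> D" for b v
    unfolding S_def
    by (intro add_nonneg_nonneg sum_nonneg) (simp_all add: payment_bounds D_pos[OF that])
  have S_mono: "S b v \<le> S c v" if "b \<in> D" "\<And>w. w \<in> ?V \<Longrightarrow> b w \<le> c w" for b c v
    unfolding S_def
    by (intro add_left_mono sum_mono payment_le) (simp_all add: that D_pos[OF that(1)])
  have bound: "S b v \<le> real (external_assets F v) +
      (\<Sum>e \<in> in_arcs (bank_graph F) v. real (liability F e))" if "b \<in> D" for b v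
    unfolding S_def
    by (intro add_left_mono sum_mono) (simp add: payment_bounds D_pos[OF that])
  have bdd: "bdd_above ((\<lambda>b. b v) ` X)" if "v \<in> ?V" for v
  proof (rule bdd_aboveI2)
    fix b assume "b \<in> X"
    then have "b v \<le> S b v" "b \<in> D" using that by (simp_all add: X_def)
    then show "b v \<le> real (external_assets F v) +
      (\<Sum>e \<in> in_arcs (bank_graph F) v. real (liability F e))"
      using bound order_trans by blast
  qed
  have "restrict (\<lambda>_. 0) ?V \<in> D" by (simp add: D_def)
  then have zero: "restrict (\<lambda>_. 0) ?V \<in> X" using S_pos by (simp add: X_def)
  have upper: "b v \<le> a v" if "b \<in> X" "v \<in> ?V" for b v
    using cSUP_upper[OF that(1) bdd[OF that(2)]] that(2) by (simp add: a_def)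
  have "0 \<le> a v" if "v \<in> ?V" for v
    using upper[OF zero that] that by simp
  then have a_dom: "a \<in> D"
    unfolding D_def by (intro PiE_I) (simp, simp add: a_def)
  have le: "a v \<le> S a v" if "v \<in> ?V" for v
  proof -
    have "b v \<le> S a v" if "b \<in> X" for b
    proof -
      have "b v \<le> S b v" "b \<in> D" using that \<open>v \<in> ?V\<close> by (simp_all add: X_def)
      then show ?thesis using S_mono[of b a v] upper[OF that] by force
    qed
    then have "(SUP b\<in>X. b v) \<le> S a v" using zero by (intro cSUP_least) blast+
    then show ?thesis using that by (simp add: a_def)
  qed
  have "restrict (S a) ?V \<in> D" by (simp add: D_def Pi_iff S_pos[OF a_dom])
  moreover have "S a v \<le> S (restrict (S a) ?V) v" for v
    by (rule S_mono[OF a_dom]) (simp add: le)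
  ultimately have "restrict (S a) ?V \<in> X" by (simp add: X_def)
  then have "S a v \<le> a v" if "v \<in> ?V" for v using upper that by force
  then have "feasible F a" using a_dom le by (simp add: feas order_antisym)
  moreover have "b \<le> a" if "feasible F b" for b
  proof (rule le_funI)
    fix v
    have "b \<in> X" "b \<in> D" using that by (simp_all add: feas X_def)
    then show "b v \<le> a v"
      using upper[of b v] PiE_arb[of b ?V _ v] PiE_arb[of a ?V _ v] a_dom
      by (cases "v \<in> ?V") (simp_all add: D_def)
  qed
  ultimately show ?thesis by blast
qed

lemma feasible_total_assets: "feasible F (total_assets F)"
  and total_assets_greatest: "feasible F b \<Longrightarrow> b \<le> total_assets F"
proof -
  obtain a where a: "feasible F a" "\<And>b. feasible F b \<Longrightarrow> b \<le> a"
    using greatest_feasible_exists by blast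
  then have "total_assets F = a" unfolding total_assets_def by (rule Greatest_equality)
  with a show "feasible F (total_assets F)" "feasible F b \<Longrightarrow> b \<le> total_assets F" by simp_all
qed

lemma swapped_multinetwork:
  assumes "debt_swap F e1 e2"
  shows "financial_multinetwork (swapped F e1 e2)"
proof -
  let ?G = "bank_graph F" and ?F' = "swapped F e1 e2"
  have e12: "e1 \<in> arcs ?G" "e2 \<in> arcs ?G"
    and ends: "tail ?G e1 \<noteq> head ?G e2" "tail ?G e2 \<noteq> head ?G e1"
    using assms by (auto simp: debt_swap_def)
  have verts: "verts (bank_graph ?F') = verts ?G" and arcs: "arcs (bank_graph ?F') = arcs ?G"
    and tail: "tail (bank_graph ?F') = tail ?G"
    and head: "head (bank_graph ?F') = (head ?G)(e1 := head ?G e2, e2 := head ?G e1)"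
    and liability: "liability ?F' = liability F" and payment: "payment ?F' = payment F"
    by (simp_all add: swapped_def)
  have out: "out_arcs (bank_graph ?F') v = out_arcs ?G v" for v
    by (simp add: out_arcs_def arcs tail)
  have total: "total_liability ?F' v = total_liability F v" for v
    by (simp add: total_liability_def out liability)
  show ?thesis
  proof unfold_locales
    fix e assume "e \<in> arcs (bank_graph ?F')"
    then have e: "e \<in> arcs ?G" by (simp add: arcs)
    show "tail (bank_graph ?F') e \<in> verts (bank_graph ?F')"
      using e by (simp add: verts tail)
    show "head (bank_graph ?F') e \<in> verts (bank_graph ?F')"
      using e e12 by (simp add: verts head)
    show "tail (bank_graph ?F') e \<noteq> head (bank_graph ?F') e"
      using no_loops[OF e] ends by (simp add: tail head)
    show "0 < liability ?F' e"
      using liability_pos[OF e] by (simp add: liability)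
    show "payment ?F' e \<in> {0..} \<rightarrow> {0..real (liability ?F' e)}"
      using payment_range[OF e] unfolding liability payment .
    show "continuous_on {0..} (payment ?F' e)"
      using payment_continuous[OF e] unfolding payment .
    show "mono_on {0..} (payment ?F' e)"
      using payment_mono[OF e] unfolding payment .
  next
    show "finite (verts (bank_graph ?F'))" "finite (arcs (bank_graph ?F'))"
      by (simp_all add: verts arcs)
  next
    fix v and b :: real assume "v \<in> verts (bank_graph ?F')" "0 \<le> b"
    then show "(\<Sum>e \<in> out_arcs (bank_graph ?F') v. payment ?F' e b) = min b (total_liability ?F' v)"
      using payment_sum[of v b] unfolding verts out payment total by simp
  qed
qed

end

end

theory Submission
  imports Defs
begin

text \<open>By Tarski, the clearing state dominates every post-fixed point of the map that sends a vector
  of assets to the resulting receipts. The swap affects the receipts of the two creditors only, so if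
  neither of them loses, the pointwise maximum of the two clearing states is post-fixed after the swap,
  and nobody loses; symmetrically, if neither of them gains, nobody gains. It remains to exclude that
  both gain in a Pareto improvement. Then no gaining bank is able to pay all its debts before the
  swap, so its next marginal unit goes entirely to one arc, and the head of that arc gains as well.
  Following these arcs leads to a cycle of gaining banks along which more money could circulate before
  the swap, against the maximality of the clearing state.\<close>

text \<open>Right-hand side of the feasibility equation, as a map on vectors that need not be
  extensional or non-negative.\<close>

definition receipts :: "('v, 'e) network \<Rightarrow> ('v \<Rightarrow> real) \<Rightarrow> 'v \<Rightarrow> real" where
  "receipts F b v = real (external_assets F v) +
    (\<Sum>e \<in> in_arcs (bank_graph F) v. payment F e (b (tail (bank_graph F) e)))"

text \<open>Among the nonempty subsets that \<open>f\<close> maps into themselves, one of least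
  cardinality works, since its image is again such a subset. This extracts the cycles of paying
  arcs.\<close>

lemma finite_self_map_surjective_subset:
  assumes "finite S" "S \<noteq> {}" "f ` S \<subseteq> S"
  obtains T where "T \<subseteq> S" "T \<noteq> {}" "f ` T = T"
proof -
  let ?P = "\<lambda>T. T \<subseteq> S \<and> T \<noteq> {} \<and> f ` T \<subseteq> T"
  have "?P S" using assms by blast
  from ex_has_least_nat[of ?P, OF this, of card]
  obtain T where T: "?P T" and least: "\<And>U. ?P U \<Longrightarrow> card T \<le> card U"
    by blast
  have "card T \<le> card (f ` T)" using T by (intro least) blast
  moreover have "finite T" using T assms(1) finite_subset by blast
  ultimately have "f ` T = T" using T by (intro card_seteq) auto
  with T that show ?thesis by blast
qed

section \<open>Post-fixed points of the receipts map\<close>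

context financial_multinetwork
begin

lemma feasible_iff_receipts:
  "feasible F b \<longleftrightarrow> b \<in> verts (bank_graph F) \<rightarrow>\<^sub>E {0..} \<and>
    (\<forall>v \<in> verts (bank_graph F). b v = receipts F b v)"
  by (simp only: feasible_def receipts_def)

lemma receipts_mono:
  assumes "\<And>w. w \<in> verts (bank_graph F) \<Longrightarrow> 0 \<le> b w"
    and "\<And>w. w \<in> verts (bank_graph F) \<Longrightarrow> b w \<le> c w"
  shows "receipts F b v \<le> receipts F c v"
  unfolding receipts_def by (intro add_left_mono sum_mono payment_le) (simp_all add: assms)

lemma receipts_nonneg:
  assumes "\<And>w. w \<in> verts (bank_graph F) \<Longrightarrow> 0 \<le> b w"
  shows "0 \<le> receipts F b v"
  unfolding receipts_def
  by (intro add_nonneg_nonneg sum_nonneg) (simp_all add: payment_bounds assms)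

lemma receipts_le_liabilities:
  assumes "\<And>w. w \<in> verts (bank_graph F) \<Longrightarrow> 0 \<le> b w"
  shows "receipts F b v \<le> real (external_assets F v) +
    (\<Sum>e \<in> in_arcs (bank_graph F) v. real (liability F e))"
  unfolding receipts_def by (intro add_left_mono sum_mono) (simp add: payment_bounds assms)

lemma total_assets_nonneg: "v \<in> verts (bank_graph F) \<Longrightarrow> 0 \<le> total_assets F v"
  using PiE_mem[OF feasible_total_assets[unfolded feasible_def, THEN conjunct1]] by simp

lemma total_assets_receipts:
  "v \<in> verts (bank_graph F) \<Longrightarrow> total_assets F v = receipts F (total_assets F) v"
  using feasible_total_assets by (auto simp: feasible_iff_receipts)

text \<open>The supremum of all post-fixed points is a fixed point; it exists because receipts never
  exceed external assets plus incoming liabilities. Covering arbitrary post-fixed \<open>b\<close>,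
  not only feasible ones, allows maxima and perturbed vectors to be used directly.\<close>

lemma le_total_assets:
  assumes nonneg: "\<And>w. w \<in> verts (bank_graph F) \<Longrightarrow> 0 \<le> b w"
    and post: "\<And>w. w \<in> verts (bank_graph F) \<Longrightarrow> b w \<le> receipts F b w"
    and v: "v \<in> verts (bank_graph F)"
  shows "b v \<le> total_assets F v"
proof -
  let ?V = "verts (bank_graph F)"
  define X where "X = {c. \<forall>w \<in> ?V. 0 \<le> c w \<and> c w \<le> receipts F c w}"
  define s where "s w = (SUP c\<in>X. c w)" for w
  have b: "b \<in> X" using nonneg post by (simp add: X_def)
  have bdd: "bdd_above ((\<lambda>c. c w) ` X)" if "w \<in> ?V" for w
  proof (rule bdd_aboveI2)
    fix c assume "c \<in> X"
    then have "c w \<le> receipts F c w" "\<And>u. u \<in> ?V \<Longrightarrow> 0 \<le> c u"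
      using that by (simp_all add: X_def)
    then show "c w \<le> real (external_assets F w) +
        (\<Sum>e \<in> in_arcs (bank_graph F) w. real (liability F e))"
      using receipts_le_liabilities[of c w] by (meson order_trans)
  qed
  have upper: "c w \<le> s w" if "c \<in> X" "w \<in> ?V" for c w
    unfolding s_def using cSUP_upper[OF that(1) bdd[OF that(2)]] .
  have s_nonneg: "0 \<le> s w" if "w \<in> ?V" for w
    using nonneg[OF that] upper[OF b that] by simp
  have s_post: "s w \<le> receipts F s w" if w: "w \<in> ?V" for w
    unfolding s_def[of w]
  proof (rule cSUP_least)
    show "X \<noteq> {}" using b by blast
    fix c assume c: "c \<in> X"
    then have "c w \<le> receipts F c w" using w by (simp add: X_def)
    also have "\<dots> \<le> receipts F s w"
      using c upper by (intro receipts_mono) (simp_all add: X_def)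
    finally show "c w \<le> receipts F s w" .
  qed
  \<comment> \<open>By monotonicity the receipts of a post-fixed point are post-fixed, hence lie
    below \<open>s\<close>.\<close>
  have "receipts F s \<in> X"
    unfolding X_def using s_nonneg s_post by (simp add: receipts_mono receipts_nonneg)
  then have s_fixed: "s w = receipts F s w" if "w \<in> ?V" for w
    using upper s_post that by (simp add: antisym)
  \<comment> \<open>Feasible vectors are extensional, so \<open>s\<close> is cut down to the banks;
    receipts read only values at tails, which are banks.\<close>
  have "receipts F (restrict s ?V) w = receipts F s w" for w
    unfolding receipts_def by (intro arg_cong2[of _ _ _ _ "(+)"] sum.cong) simp_all
  then have "feasible F (restrict s ?V)"
    using s_nonneg s_fixed by (auto simp: feasible_iff_receipts)
  from total_assets_greatest[OF this, THEN le_funD, of v]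
  show ?thesis using v upper[OF b v] by simp
qed

section \<open>Conservation of money\<close>

text \<open>Every arc enters exactly one bank and leaves exactly one, so payments grouped by
  creditor can be regrouped by debtor.\<close>

lemma sum_receipts:
  assumes "\<And>v. v \<in> verts (bank_graph F) \<Longrightarrow> 0 \<le> b v"
  shows "(\<Sum>v \<in> verts (bank_graph F). receipts F b v) =
    (\<Sum>v \<in> verts (bank_graph F). real (external_assets F v)) +
    (\<Sum>v \<in> verts (bank_graph F). min (b v) (total_liability F v))"
proof -
  let ?G = "bank_graph F" and ?p = "\<lambda>e. payment F e (b (tail (bank_graph F) e))"
  have "(\<Sum>v \<in> verts ?G. \<Sum>e \<in> in_arcs ?G v. ?p e) = (\<Sum>e \<in> arcs ?G. ?p e)"
    unfolding in_arcs_def by (rule sum.group) auto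
  also have "\<dots> = (\<Sum>v \<in> verts ?G. \<Sum>e \<in> out_arcs ?G v. ?p e)"
    unfolding out_arcs_def by (rule sum.group[symmetric]) auto
  also have "\<dots> = (\<Sum>v \<in> verts ?G. \<Sum>e \<in> out_arcs ?G v. payment F e (b v))"
    by (intro sum.cong refl) simp
  also have "\<dots> = (\<Sum>v \<in> verts ?G. min (b v) (total_liability F v))"
    by (intro sum.cong refl payment_sum assms)
  finally show ?thesis by (simp add: receipts_def sum.distrib)
qed

text \<open>Payments cancel when the clearing equation is summed over all banks. The right-hand side
  involves no arc, which makes the left-hand side invariant under swaps.\<close>

lemma sum_unpassed_assets:
  "(\<Sum>v \<in> verts (bank_graph F). total_assets F v - min (total_assets F v) (total_liability F v)) =
    (\<Sum>v \<in> verts (bank_graph F). real (external_assets F v))"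
proof -
  have "sum (total_assets F) (verts (bank_graph F)) =
      sum (receipts F (total_assets F)) (verts (bank_graph F))"
    by (rule sum.cong[OF refl]) (rule total_assets_receipts)
  then show ?thesis
    using sum_receipts[of "total_assets F"] total_assets_nonneg by (simp add: sum_subtractf)
qed

section \<open>Marginal payments under an edge ranking\<close>

text \<open>The witness is the highest-ranked arc that is not yet fully paid.\<close>

lemma edge_ranking_active_arc:
  assumes v: "v \<in> verts (bank_graph F)" and rank: "uses_edge_ranking F v"
    and x: "0 \<le> x" "x < total_liability F v"
  obtains e d where "e \<in> out_arcs (bank_graph F) v" "0 < d"
    "\<And>\<delta>. 0 \<le> \<delta> \<Longrightarrow> \<delta> \<le> d \<Longrightarrow> payment F e (x + \<delta>) = payment F e x + \<delta>"
proof -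
  let ?O = "out_arcs (bank_graph F) v"
  obtain r where r: "linear_order_on ?O r"
    and pay: "\<And>e b. e \<in> ?O \<Longrightarrow> 0 \<le> b \<Longrightarrow>
      payment F e b = min (real (liability F e)) (b - (\<Sum>e' \<in> underS r e. payment F e' b))"
    using rank unfolding uses_edge_ranking_def by blast
  from r have sub: "r \<subseteq> ?O \<times> ?O"
    unfolding linear_order_on_def by (blast dest: partial_order_onD(4))
  have "finite r" using sub by (rule finite_subset) (simp add: finite_out_arcs)
  then have wf: "wf (r - Id)"
    using r unfolding linear_order_on_def by (blast intro: partial_order_on_well_order_on)
  have "\<exists>e \<in> ?O. payment F e x < real (liability F e)"
  proof (rule ccontr)
    assume "\<not> ?thesis"
    then have "total_liability F v \<le> (\<Sum>e \<in> ?O. payment F e x)"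
      unfolding total_liability_def by (intro sum_mono) (simp add: not_less)
    then show False using payment_sum[OF v x(1)] x(2) by simp
  qed
  then obtain e where e: "e \<in> ?O" "payment F e x < real (liability F e)"
    and first: "\<And>e'. (e', e) \<in> r - Id \<Longrightarrow> e' \<notin> {e \<in> ?O. payment F e x < real (liability F e)}"
    using wfE_min'[OF wf, of "{e \<in> ?O. payment F e x < real (liability F e)}"] by blast
  let ?c = "\<Sum>e' \<in> underS r e. real (liability F e')"
  \<comment> \<open>Arcs ranked before \<open>e\<close> are full at \<open>x\<close> and stay full
    at every \<open>y\<close> above \<open>x\<close>, so the recursive payment rule becomes explicit
    with the constant \<open>?c\<close>.\<close>
  have above: "payment F e y = min (real (liability F e)) (y - ?c)" if "x \<le> y" for y
  proof -
    have "payment F e' y = real (liability F e')" if "e' \<in> underS r e" for e'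
    proof -
      have "(e', e) \<in> r - Id" using that by (simp add: underS_def)
      with first[OF this] sub have e': "e' \<in> arcs (bank_graph F)"
        "real (liability F e') \<le> payment F e' x" by auto
      have "payment F e' x \<le> payment F e' y"
        using payment_le[OF e'(1) x(1) \<open>x \<le> y\<close>] .
      moreover have "payment F e' y \<le> real (liability F e')"
        using payment_bounds[OF e'(1)] x(1) \<open>x \<le> y\<close> by simp
      ultimately show ?thesis using e'(2) by simp
    qed
    then show ?thesis using pay[OF e(1), of y] x(1) that by simp
  qed
  show ?thesis
  proof (rule that[OF e(1)])
    \<comment> \<open>The window is the unpaid rest of \<open>e\<close>; within it the payment to
      \<open>e\<close> has slope one.\<close>
    show "0 < real (liability F e) - payment F e x" using e(2) by simp
    fix \<delta> assume \<delta>: "0 \<le> \<delta>" "\<delta> \<le> real (liability F e) - payment F e x"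
    have "payment F e x = x - ?c" using above[of x] e(2) by linarith
    then show "payment F e (x + \<delta>) = payment F e x + \<delta>"
      using above[of "x + \<delta>"] \<delta> by linarith
  qed
qed

end

section \<open>Comparison of two networks on the same banks\<close>

locale same_banks = A: financial_multinetwork F + B: financial_multinetwork F'
  for F F' :: "('v, 'e) network" +
  assumes verts_eq: "verts (bank_graph F') = verts (bank_graph F)"
begin

text \<open>The pointwise maximum of the two clearing states is a post-fixed point of the second
  network.\<close>

lemma total_assets_le_if_le_on:
  assumes off: "\<And>b w. w \<in> verts (bank_graph F) - C \<Longrightarrow> receipts F' b w = receipts F b w"
    and on: "\<And>w. w \<in> C \<Longrightarrow> total_assets F w \<le> total_assets F' w"
    and v: "v \<in> verts (bank_graph F)"
  shows "total_assets F v \<le> total_assets F' v"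
proof -
  define m where "m w = max (total_assets F w) (total_assets F' w)" for w
  have nonneg: "0 \<le> m w" if "w \<in> verts (bank_graph F)" for w
    using A.total_assets_nonneg[OF that] by (simp add: m_def le_max_iff_disj)
  have B_le: "total_assets F' w \<le> receipts F' m w" if "w \<in> verts (bank_graph F)" for w
    using B.total_assets_receipts[of w] that B.total_assets_nonneg
      B.receipts_mono[of "total_assets F'" m w]
    by (simp add: verts_eq m_def)
  have A_le: "total_assets F w \<le> receipts F m w" if "w \<in> verts (bank_graph F)" for w
    using A.total_assets_receipts[OF that] A.total_assets_nonneg
      A.receipts_mono[of "total_assets F" m w]
    by (simp add: m_def)
  \<comment> \<open>On \<open>C\<close> the maximum is the clearing state of \<open>F'\<close>, so
    \<open>B_le\<close> suffices; off \<open>C\<close> the bound \<open>A_le\<close> transfers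
    because the receipts agree.\<close>
  have "m w \<le> receipts F' m w" if w: "w \<in> verts (bank_graph F)" for w
  proof (cases "w \<in> C")
    case True
    then show ?thesis using on[OF True] B_le[OF w] by (simp add: m_def)
  next
    case False
    then show ?thesis using off[of w m] A_le[OF w] B_le[OF w] w by (simp add: m_def)
  qed
  then have "m v \<le> total_assets F' v"
    using nonneg v by (intro B.le_total_assets) (simp_all add: verts_eq)
  then show ?thesis by (simp add: m_def)
qed

end

section \<open>The network before and after a swap\<close>

locale swapped_network = financial_multinetwork F for F :: "('v, 'e) network" +
  fixes e1 e2
  assumes swap: "debt_swap F e1 e2"
begin

abbreviation "F' \<equiv> swapped F e1 e2"
abbreviation "creditors \<equiv> {head (bank_graph F) e1, head (bank_graph F) e2}"

lemma swapped_simps [simp]: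
  "verts (bank_graph F') = verts (bank_graph F)"
  "arcs (bank_graph F') = arcs (bank_graph F)"
  "tail (bank_graph F') = tail (bank_graph F)"
  "liability F' = liability F" "payment F' = payment F"
  "external_assets F' = external_assets F"
  by (simp_all add: swapped_def)

lemma total_liability_swapped [simp]: "total_liability F' = total_liability F"
  by (simp add: fun_eq_iff total_liability_def out_arcs_def)

sublocale after_swap: same_banks F F'
proof -
  interpret B: financial_multinetwork F' by (rule swapped_multinetwork[OF swap])
  show "same_banks F F'" by unfold_locales simp
qed

sublocale before_swap: same_banks F' F
  by unfold_locales simp

lemma receipts_swapped:
  assumes "w \<notin> creditors"
  shows "receipts F' b w = receipts F b w"
proof -
  have "in_arcs (bank_graph F') w = in_arcs (bank_graph F) w"
    using assms by (auto simp: in_arcs_def swapped_def)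
  then show ?thesis by (simp add: receipts_def)
qed

text \<open>Assets minus payments add up to the external assets both before and after the swap, so every
  gain must be passed on in full.\<close>

lemma total_assets_less_total_liability:
  assumes le: "\<And>w. w \<in> verts (bank_graph F) \<Longrightarrow> total_assets F w \<le> total_assets F' w"
    and v: "v \<in> verts (bank_graph F)" "total_assets F v < total_assets F' v"
  shows "total_assets F v < total_liability F v"
proof (rule ccontr)
  assume less: "\<not> ?thesis"
  \<comment> \<open>What a bank keeps after paying; it never decreases with the assets, and
    increases strictly once they reach the total liability.\<close>
  define g where "g a w = a w - min (a w) (total_liability F w)" for a :: "'v \<Rightarrow> real" and w
  let ?V = "verts (bank_graph F)" and ?a = "total_assets F" and ?a' = "total_assets F'"
  have "sum (g ?a) ?V = (\<Sum>w \<in> ?V. real (external_assets F w))"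
    using sum_unpassed_assets by (simp add: g_def)
  moreover have "sum (g ?a') ?V = (\<Sum>w \<in> ?V. real (external_assets F w))"
    using after_swap.B.sum_unpassed_assets by (simp add: g_def)
  moreover have "sum (g ?a) ?V < sum (g ?a') ?V"
  proof (rule sum_strict_mono_ex1)
    show "\<forall>w\<in>?V. g ?a w \<le> g ?a' w" using le by (fastforce simp: g_def min_def)
    show "\<exists>w\<in>?V. g ?a w < g ?a' w" using v less by (force simp: g_def)
  qed simp
  ultimately show False by simp
qed

lemma not_both_creditors_gain:
  assumes rank: "\<And>v. v \<in> verts (bank_graph F) \<Longrightarrow> uses_edge_ranking F v"
    and le: "\<And>w. w \<in> verts (bank_graph F) \<Longrightarrow> total_assets F w \<le> total_assets F' w"
    and creditors_gain: "\<And>w. w \<in> creditors \<Longrightarrow> total_assets F w < total_assets F' w"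
  shows False
proof -
  let ?V = "verts (bank_graph F)" and ?a = "total_assets F" and ?a' = "total_assets F'"
  let ?hd = "head (bank_graph F)" and ?tl = "tail (bank_graph F)"
  define S where "S = {v \<in> ?V. ?a v < ?a' v}"
  have "\<exists>e d. e \<in> out_arcs (bank_graph F) v \<and> 0 < d \<and>
      (\<forall>\<delta>. 0 \<le> \<delta> \<longrightarrow> \<delta> \<le> d \<longrightarrow> payment F e (?a v + \<delta>) = payment F e (?a v) + \<delta>)"
    if "v \<in> S" for v
  proof -
    have v: "v \<in> ?V" "?a v < ?a' v" using that by (simp_all add: S_def)
    show ?thesis
      using edge_ranking_active_arc[OF v(1) rank[OF v(1)] total_assets_nonneg[OF v(1)]
        total_assets_less_total_liability[OF le v]] by metis
  qed
  then obtain act d where act: "\<And>v. v \<in> S \<Longrightarrow> act v \<in> out_arcs (bank_graph F) v"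
    and d: "\<And>v. v \<in> S \<Longrightarrow> 0 < d v"
    and slope: "\<And>v \<delta>. v \<in> S \<Longrightarrow> 0 \<le> \<delta> \<Longrightarrow> \<delta> \<le> d v \<Longrightarrow>
      payment F (act v) (?a v + \<delta>) = payment F (act v) (?a v) + \<delta>"
    by metis
  have "finite S" by (simp add: S_def)
  have "?hd e1 \<in> ?V" using swap by (simp add: debt_swap_def)
  then have "S \<noteq> {}" using creditors_gain by (auto simp: S_def)
  \<comment> \<open>The swap changes the incoming arcs of the creditors, so their gain comes from
    the hypothesis; any other bank keeps its incoming arcs and receives strictly more along the
    active arc.\<close>
  have "?hd (act v) \<in> S" if v: "v \<in> S" for v
  proof (cases "?hd (act v) \<in> creditors")
    case True
    then show ?thesis using creditors_gain act[OF v] by (auto simp: S_def)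
  next
    case False
    let ?w = "?hd (act v)"
    \<comment> \<open>Capped by the actual gain of \<open>v\<close>, so that monotonicity carries
      the strict increase on to \<open>?a' v\<close>.\<close>
    define \<delta> where "\<delta> = min (d v) (?a' v - ?a v)"
    have \<delta>: "0 < \<delta>" "\<delta> \<le> d v" "?a v + \<delta> \<le> ?a' v"
      using v d by (auto simp: \<delta>_def S_def)
    have arc: "act v \<in> arcs (bank_graph F)" "?tl (act v) = v" using act[OF v] by auto
    have w: "?w \<in> ?V" using arc by simp
    have "payment F (act v) (?a v) < payment F (act v) (?a v + \<delta>)"
      using slope[OF v, of \<delta>] \<delta> by simp
    also have "\<dots> \<le> payment F (act v) (?a' v)"
      using \<delta> v arc(1) total_assets_nonneg[of v] by (intro payment_le) (auto simp: S_def)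
    finally have "receipts F ?a ?w < receipts F ?a' ?w"
      unfolding receipts_def using arc le total_assets_nonneg
      by (intro add_strict_left_mono sum_strict_mono_ex1 ballI payment_le bexI[of _ "act v"]) auto
    then have "?a ?w < ?a' ?w"
      using total_assets_receipts[OF w] after_swap.B.total_assets_receipts[of ?w] w
        receipts_swapped[OF False] by simp
    then show ?thesis using w by (simp add: S_def)
  qed
  then have "(?hd \<circ> act) ` S \<subseteq> S" by auto
  \<comment> \<open>Surjectivity is what matters: each bank of \<open>T\<close> is paid by the
    active arc of some bank of \<open>T\<close>.\<close>
  then obtain T where T: "T \<subseteq> S" "T \<noteq> {}" "(?hd \<circ> act) ` T = T"
    using finite_self_map_surjective_subset \<open>finite S\<close> \<open>S \<noteq> {}\<close> by metis
  have "finite T" using T \<open>finite S\<close> finite_subset by blast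
  \<comment> \<open>One amount that fits the windows of all active arcs of \<open>T\<close>; below,
    it circulates through \<open>T\<close> in the network before the swap.\<close>
  define \<epsilon> where "\<epsilon> = Min (d ` T)"
  have \<epsilon>: "0 < \<epsilon>" "\<And>v. v \<in> T \<Longrightarrow> \<epsilon> \<le> d v"
    using T d \<open>finite T\<close> by (auto simp: \<epsilon>_def)
  define b where "b w = ?a w + (if w \<in> T then \<epsilon> else 0)" for w
  have b_ge: "?a w \<le> b w" for w using \<epsilon> by (simp add: b_def)
  have b_nonneg: "0 \<le> b w" if "w \<in> ?V" for w
    using b_ge[of w] total_assets_nonneg[OF that] by simp
  have "b w \<le> receipts F b w" if w: "w \<in> ?V" for w
  proof (cases "w \<in> T")
    case False
    then show ?thesis
      using total_assets_receipts[OF w] receipts_mono[of ?a b w] b_ge total_assets_nonneg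
      by (simp add: b_def)
  next
    case True
    then obtain v where v: "v \<in> T" "w = ?hd (act v)" using T(3) by force
    then have "v \<in> S" using T(1) by blast
    have arc: "act v \<in> in_arcs (bank_graph F) w" "?tl (act v) = v"
      using act[OF \<open>v \<in> S\<close>] v(2) by auto
    have "\<epsilon> = payment F (act v) (b v) - payment F (act v) (?a v)"
      using slope[OF \<open>v \<in> S\<close>, of \<epsilon>] \<epsilon> v(1) by (simp add: b_def)
    \<comment> \<open>Abstracted into a function so that one summand can be bounded by the sum of
      non-negative terms.\<close>
    also have "\<dots> = (\<lambda>e. payment F e (b (?tl e)) - payment F e (?a (?tl e))) (act v)"
      using arc by simp
    also have "\<dots> \<le> (\<Sum>e \<in> in_arcs (bank_graph F) w.
        payment F e (b (?tl e)) - payment F e (?a (?tl e)))"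
      using arc b_ge total_assets_nonneg by (intro member_le_sum) (auto intro: payment_le)
    also have "\<dots> = receipts F b w - receipts F ?a w"
      by (simp add: receipts_def sum_subtractf)
    finally show ?thesis
      using total_assets_receipts[OF w] True by (simp add: b_def)
  qed
  then have "b v \<le> ?a v" if "v \<in> ?V" for v
    using le_total_assets b_nonneg that by blast
  moreover obtain v where "v \<in> T" using T(2) by blast
  ultimately show False using T(1) \<epsilon>(1) by (force simp: b_def S_def)
qed

end

section \<open>Semi-positive versus Pareto-improving swaps\<close>

theorem theorem2:
  fixes F :: "('v, 'e) network"
    and e1 e2 :: 'e
  assumes "financial_network F"
    and "\<And>v. v \<in> verts (bank_graph F) \<Longrightarrow> uses_edge_ranking F v"
    and "debt_swap F e1 e2"
  shows "semi_positive F e1 e2 \<longleftrightarrow> pareto_improving F e1 e2"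
proof -
  interpret financial_network F by fact
  interpret swapped_network F e1 e2 by unfold_locales fact
  let ?V = "verts (bank_graph F)" and ?a = "total_assets F" and ?a' = "total_assets F'"
  have creditors: "head (bank_graph F) e1 \<in> ?V" "head (bank_graph F) e2 \<in> ?V"
    using assms(3) by (simp_all add: debt_swap_def)
  have gain: "\<forall>w \<in> ?V. ?a w \<le> ?a' w" if "\<forall>w \<in> creditors. ?a w \<le> ?a' w"
  proof
    fix w assume "w \<in> ?V"
    then show "?a w \<le> ?a' w"
    proof (rule after_swap.total_assets_le_if_le_on[rotated 2])
      show "?a u \<le> ?a' u" if "u \<in> creditors" for u
        using that \<open>\<forall>w \<in> creditors. ?a w \<le> ?a' w\<close> by blast
    qed (use receipts_swapped in blast)
  qed
  \<comment> \<open>The same comparison with the roles of the two networks exchanged.\<close>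
  have loss: "\<forall>w \<in> ?V. ?a' w \<le> ?a w" if "\<forall>w \<in> creditors. ?a' w \<le> ?a w"
  proof
    fix w assume "w \<in> ?V"
    then have "w \<in> verts (bank_graph F')" by simp
    then show "?a' w \<le> ?a w"
    proof (rule before_swap.total_assets_le_if_le_on[rotated 2])
      show "?a' u \<le> ?a u" if "u \<in> creditors" for u
        using that \<open>\<forall>w \<in> creditors. ?a' w \<le> ?a w\<close> by blast
    qed (use receipts_swapped[symmetric] in blast)
  qed
  show ?thesis
  proof
    assume "semi_positive F e1 e2"
    then have "\<forall>w \<in> creditors. ?a w \<le> ?a' w" "\<exists>w \<in> creditors. ?a w < ?a' w"
      unfolding semi_positive_def Let_def by blast+
    then show "pareto_improving F e1 e2"
      using gain creditors unfolding pareto_improving_def Let_def by blast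
  next
    assume "pareto_improving F e1 e2"
    then have le: "\<forall>w \<in> ?V. ?a w \<le> ?a' w" and strict: "\<exists>w \<in> ?V. ?a w < ?a' w"
      unfolding pareto_improving_def Let_def by blast+
    have "\<not> (\<forall>w \<in> creditors. ?a w < ?a' w)"
      using not_both_creditors_gain assms(2) le by blast
    \<comment> \<open>If neither creditor gained, no bank at all could gain.\<close>
    moreover have "\<not> (\<forall>w \<in> creditors. ?a' w \<le> ?a w)"
      using loss strict not_less by blast
    ultimately show "semi_positive F e1 e2"
      using le creditors unfolding semi_positive_def Let_def by (simp add: not_le) blast
  qed
qed

end
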